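(* Let $(C,\phi,F)$ be a semicoherent $n$-component system with $C=\{1,\ldots,n\}$ whose component lifetimes $T_1,\ldots,T_n$ have no ties, and let $d\colon 2^C\to\mathbb{R}$ be its signed domination function. Assume that $$q_j(A)=\frac{1}{n\binom{n-1}{|A|}}\qquad\text{for all } j\in C \text{ and all } A\subseteq C\setminus\{j\}.$$ Then for every nonempty set $M\subseteq C$ with $m=|M|$ and every $k\in\{1,\ldots,m\}$, the probability $s_M^{(k)}=\Pr(T_C=T_{k:M})$ satisfies $$ s_M^{(k)} = \sum_{A\subseteq C,\ k-1\leq|M\setminus A|\leq m-1}d(A)\,\frac{m-|M\setminus A|}{k}\,\frac{\binom{|M\setminus A|}{k-1}}{\binom{|M\setminus A|+|A|}{k}}, $$ or equivalently, $$ s_M^{(k)} = \sum_{A\subseteq C}d(A)\,\frac{m-|M\setminus A|}{k}\,\frac{\binom{|M\setminus A|}{k-1}}{\binom{|M\setminus A|+|A|}{k}}. $$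
   Context: $C=\{1,\ldots,n\}$ is the set of components. $T_1,\ldots,T_n$ are nonnegative real random variables on a common probability space (the component lifetimes), with joint c.d.f. $F$, and there are no ties: $\Pr(T_i=T_j)=0$ for all distinct $i,j\in C$. The structure function $\phi\colon\{0,1\}^n\to\{0,1\}$ is identified with a set function $\phi\colon 2^C\to\{0,1\}$ (identify $(x_1,\ldots,x_n)$ with $A=\{i: x_i=1\}$). The system is semicoherent: $\phi$ is nondecreasing in each variable, $\phi(\varnothing)=0$ and $\phi(C)=1$. The system lifetime is $T_C=\max_{A\subseteq C,\ \phi(A)=1}\min_{i\in A}T_i$. For nonempty $M\subseteq C$ with $m=|M|$, $T_{k:M}$ is the $k$th smallest of the variables $T_i$, $i\in M$ ($k$th order statistic). For $j\in C$ and $A\subseteq C\setminus\{j\}$: $q_j(A)=\Pr\big(\max_{i\in C\setminus A}T_i=T_j<\min_{i\in A}T_i\big)$, where the minimum over the empty set is $+\infty$. The signed domination function $d$ gives the coefficients of the unique multilinear expression $\phi(x_1,\ldots,x_n)=\sum_{A\subseteq C}d(A)\prod_{i\in A}x_i$; equivalently $d(A)=\sum_{B\subseteq A}(-1)^{|A|-|B|}\phi(B)$. As usual $\binom{a}{b}=0$ for integers $0\le a<b$. *)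

theory Defs
  imports "HOL-Probability.Probability"
begin

text \<open>
  Components are the elements of \<open>{1..n}\<close>.  A structure function on \<open>{0,1}\<^sup>n\<close> is
  given as a set function: \<open>\<phi> A\<close> is its value at the characteristic vector of \<open>A\<close>.
  Only the values on subsets of \<open>{1..n}\<close> are ever used.
\<close>

definition semicoherent :: "nat \<Rightarrow> (nat set \<Rightarrow> real) \<Rightarrow> bool" where
  "semicoherent n \<phi> \<longleftrightarrow>
     (\<forall>A \<subseteq> {1..n}. \<phi> A \<in> {0, 1}) \<and>
     (\<forall>A B. A \<subseteq> B \<and> B \<subseteq> {1..n} \<longrightarrow> \<phi> A \<le> \<phi> B) \<and>
     \<phi> {} = 0 \<and> \<phi> {1..n} = 1"

text \<open>
  The coefficients of the multilinear expression of \<open>\<phi>\<close>; existence and uniqueness are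
  \<open>signed_domination_iff\<close> below.
\<close>

definition signed_domination :: "nat \<Rightarrow> (nat set \<Rightarrow> real) \<Rightarrow> (nat set \<Rightarrow> real) \<Rightarrow> bool" where
  "signed_domination n \<phi> d \<longleftrightarrow>
     (\<forall>x :: nat \<Rightarrow> real. (\<forall>i\<in>{1..n}. x i \<in> {0, 1}) \<longrightarrow>
        \<phi> {i\<in>{1..n}. x i = 1} = (\<Sum>A\<in>Pow {1..n}. d A * (\<Prod>i\<in>A. x i)))"

text \<open>
  Below, \<open>t\<close> is a realization of the component lifetimes.  For a semicoherent \<open>\<phi>\<close> every
  \<open>A\<close> with \<open>\<phi> A = 1\<close> is nonempty, so \<open>Min\<close> and \<open>Max\<close> are applied to nonempty finite sets.
\<close>

definition system_lifetime :: "nat \<Rightarrow> (nat set \<Rightarrow> real) \<Rightarrow> (nat \<Rightarrow> real) \<Rightarrow> real" where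
  "system_lifetime n \<phi> t = Max ((\<lambda>A. Min (t ` A)) ` {A. A \<subseteq> {1..n} \<and> \<phi> A = 1})"

text \<open>The \<open>k\<close>th smallest value, counted with multiplicity; \<open>k\<close> starts at 1.\<close>

definition order_statistic :: "nat \<Rightarrow> nat set \<Rightarrow> (nat \<Rightarrow> real) \<Rightarrow> real" where
  "order_statistic k M t = sort (map t (sorted_list_of_set M)) ! (k - 1)"

text \<open>The infimum is taken in \<^typ>\<open>ereal\<close>, so that it is \<open>\<infinity>\<close> for \<open>A = {}\<close>.\<close>

definition rel_quality ::
  "'w measure \<Rightarrow> nat \<Rightarrow> (nat \<Rightarrow> 'w \<Rightarrow> real) \<Rightarrow> nat \<Rightarrow> nat set \<Rightarrow> real" where
  "rel_quality P n T j A =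
     measure P {\<omega>\<in>space P. Max ((\<lambda>i. T i \<omega>) ` ({1..n} - A)) = T j \<omega> \<and>
                           ereal (T j \<omega>) < (INF i\<in>A. ereal (T i \<omega>))}"

definition subsignature ::
  "'w measure \<Rightarrow> nat \<Rightarrow> (nat set \<Rightarrow> real) \<Rightarrow> (nat \<Rightarrow> 'w \<Rightarrow> real) \<Rightarrow> nat \<Rightarrow> nat set \<Rightarrow> real" where
  "subsignature P n \<phi> T k M =
     measure P {\<omega>\<in>space P. system_lifetime n \<phi> (\<lambda>i. T i \<omega>) = order_statistic k M (\<lambda>i. T i \<omega>)}"

lemma signed_domination_sum:
  "signed_domination n \<phi> d \<longleftrightarrow> (\<forall>B \<subseteq> {1..n}. \<phi> B = (\<Sum>A\<in>Pow B. d A))"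
proof -
  have sum_eq: "(\<Sum>A\<in>Pow {1..n}. d A * (\<Prod>i\<in>A. x i)) = (\<Sum>A\<in>Pow {i\<in>{1..n}. x i = 1}. d A)"
    if x: "\<forall>i\<in>{1..n}. x i \<in> {0, 1}" for x :: "nat \<Rightarrow> real"
  proof -
    have "(\<Sum>A\<in>Pow {1..n}. d A * (\<Prod>i\<in>A. x i)) =
          (\<Sum>A\<in>Pow {i\<in>{1..n}. x i = 1}. d A * (\<Prod>i\<in>A. x i))"
    proof (rule sum.mono_neutral_right)
      show "\<forall>A\<in>Pow {1..n} - Pow {i \<in> {1..n}. x i = 1}. d A * (\<Prod>i\<in>A. x i) = 0"
      proof
        fix A assume A: "A \<in> Pow {1..n} - Pow {i \<in> {1..n}. x i = 1}"
        then obtain i where "i \<in> A" "x i \<noteq> 1" "i \<in> {1..n}" by blast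
        moreover have "finite A" using A by (meson DiffD1 PowD finite_atLeastAtMost finite_subset)
        ultimately show "d A * (\<Prod>i\<in>A. x i) = 0" using x by auto
      qed
    qed auto
    also have "\<dots> = (\<Sum>A\<in>Pow {i\<in>{1..n}. x i = 1}. d A)"
      by (rule sum.cong[OF refl]) (simp add: subset_eq)
    finally show ?thesis .
  qed
  show ?thesis
  proof
    assume *: "signed_domination n \<phi> d"
    show "\<forall>B \<subseteq> {1..n}. \<phi> B = (\<Sum>A\<in>Pow B. d A)"
    proof (intro allI impI)
      fix B assume B: "B \<subseteq> {1..n}"
      define x where "x = (\<lambda>i. if i \<in> B then 1 else 0 :: real)"
      have x: "\<forall>i\<in>{1..n}. x i \<in> {0, 1}" by (simp add: x_def)
      have "{i\<in>{1..n}. x i = 1} = B" using B by (auto simp: x_def)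
      then show "\<phi> B = (\<Sum>A\<in>Pow B. d A)"
        using *[unfolded signed_domination_def, rule_format, of x] x sum_eq[OF x] by simp
    qed
  next
    assume "\<forall>B \<subseteq> {1..n}. \<phi> B = (\<Sum>A\<in>Pow B. d A)"
    then show "signed_domination n \<phi> d"
      unfolding signed_domination_def by (metis (no_types, lifting) mem_Collect_eq subsetI sum_eq)
  qed
qed

lemma signed_domination_iff:
  "signed_domination n \<phi> d \<longleftrightarrow>
     (\<forall>A \<subseteq> {1..n}. d A = (\<Sum>B\<in>Pow A. (-1) ^ (card A - card B) * \<phi> B))"
proof
  assume *: "signed_domination n \<phi> d"
  show "\<forall>A \<subseteq> {1..n}. d A = (\<Sum>B\<in>Pow A. (-1) ^ (card A - card B) * \<phi> B)"
  proof (intro allI impI)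
    fix A assume A: "A \<subseteq> {1..n}"
    then have "finite A" by (rule finite_subset) simp
    then have "d A = (\<Sum>B\<in>Pow A. (-1) ^ (card A - card B) * sum d (Pow B))"
      by (rule inclusion_exclusion_mobius[rotated]) simp
    also have "\<dots> = (\<Sum>B\<in>Pow A. (-1) ^ (card A - card B) * \<phi> B)"
    proof (rule sum.cong[OF refl])
      fix B assume "B \<in> Pow A"
      then have "B \<subseteq> {1..n}" using A by blast
      then show "(-1) ^ (card A - card B) * sum d (Pow B) = (-1) ^ (card A - card B) * \<phi> B"
        using * by (simp add: signed_domination_sum)
    qed
    finally show "d A = (\<Sum>B\<in>Pow A. (-1) ^ (card A - card B) * \<phi> B)" .
  qed
next
  assume *: "\<forall>A \<subseteq> {1..n}. d A = (\<Sum>B\<in>Pow A. (-1) ^ (card A - card B) * \<phi> B)"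
  define g where "g = (\<lambda>S. \<Sum>B\<in>Pow S. (-1) ^ card B * \<phi> B)"
  have d: "d A = (-1) ^ card A * g A" if A: "A \<subseteq> {1..n}" for A
  proof -
    have fin: "finite A" using A by (rule finite_subset) simp
    have "d A = (\<Sum>B\<in>Pow A. (-1) ^ (card A - card B) * \<phi> B)" using * A by blast
    also have "\<dots> = (\<Sum>B\<in>Pow A. (-1) ^ card A * ((-1) ^ card B * \<phi> B))"
    proof (rule sum.cong[OF refl])
      fix B assume "B \<in> Pow A"
      then have "card B \<le> card A" using fin by (auto intro: card_mono)
      then have "(-1::real) ^ (card A - card B) = (-1) ^ card A * (-1) ^ card B"
        by (metis neg_one_power_add_eq_neg_one_power_diff power_add)
      then show "(-1) ^ (card A - card B) * \<phi> B = (-1) ^ card A * ((-1) ^ card B * \<phi> B)"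
        by simp
    qed
    finally show ?thesis by (simp add: g_def sum_distrib_left)
  qed
  show "signed_domination n \<phi> d"
    unfolding signed_domination_sum
  proof (intro allI impI)
    fix B assume B: "B \<subseteq> {1..n}"
    then have "finite B" by (rule finite_subset) simp
    then have "\<phi> B = (\<Sum>A\<in>Pow B. (-1) ^ card A * g A)"
      by (rule inclusion_exclusion_symmetric[rotated]) (simp add: g_def)
    also have "\<dots> = (\<Sum>A\<in>Pow B. d A)"
      using B by (intro sum.cong[OF refl]) (auto simp: d)
    finally show "\<phi> B = (\<Sum>A\<in>Pow B. d A)" .
  qed
qed

end

theory Submission
  imports Defs
begin

text \<open>
  Fix a realization \<open>t\<close> of the lifetimes without ties, and for a component \<open>j\<close> let \<open>U\<close> be
  the set of components that outlive \<open>j\<close>.  The system dies together with \<open>j\<close> iff it works on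
  \<open>insert j U\<close> but not on \<open>U\<close>, that is, iff \<open>\<phi> (insert j U) - \<phi> U = 1\<close>; and \<open>j \<in> M\<close> is the
  \<open>k\<close>th failure in \<open>M\<close> iff \<open>card (M - U) = k\<close>, because \<open>M - U\<close> consists of the members of \<open>M\<close>
  that have failed at time \<open>t j\<close>, including \<open>j\<close>.  The relative quality \<open>q\<^sub>j(A)\<close> is precisely
  the probability of \<open>U = A\<close>.  Taking expectations gives, for an arbitrary dependence
  structure (\<open>subsignature_eq_sum_rel_quality\<close>),
  the subsignature as the sum of \<open>q\<^sub>j(A) * (\<phi> (insert j A) - \<phi> A)\<close> over all \<open>j \<in> M\<close>
  and all \<open>A \<subseteq> C - {j}\<close> with \<open>card (M - A) = k\<close>, where \<open>C = {1..n}\<close>.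

  The marginal contribution \<open>\<phi> (insert j A) - \<phi> A\<close> is the sum of \<open>d B\<close> over the sets \<open>B\<close>
  that contain \<open>j\<close> and lie in \<open>insert j A\<close>.  After exchanging the sums, the coefficient of \<open>d B\<close>
  is a sum over \<open>j \<in> M \<inter> B\<close> of the total weight \<open>q\<^sub>j(A)\<close> of the sets \<open>A\<close> between
  \<open>B - {j}\<close> and \<open>C - {j}\<close> with \<open>card (M - A) = k\<close>.  Under the hypothesis on \<open>q\<close>
  this weight depends only on \<open>card A\<close> and is the Beta integral
  \<open>a! c! / (a + c + 1)!\<close>, where \<open>a = card A\<close> and \<open>c = n - 1 - a\<close>.  Such weights are consistent
  under forgetting a component (\<open>beta_weight_pascal\<close>), so the components outside \<open>M \<union> B\<close>
  sum out.  What remains is the number of ways to choose the \<open>k - 1\<close> members of \<open>M - B\<close> that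
  fail before \<open>j\<close>, times a single weight on \<open>M \<union> B\<close>; it is the same for all
  \<open>card (M \<inter> B) = card M - card (M - B)\<close> choices of \<open>j\<close>.
\<close>

section \<open>Order statistics and system lifetimes through thresholds\<close>

text \<open>
  The values that satisfy a downward closed property fill an initial segment of a sorted list,
  so membership of the \<open>i\<close>th entry is decided by counting.  Keeping the property abstract
  covers the thresholds \<open>\<le> a\<close> and \<open>< a\<close> together.
\<close>

lemma sorted_nth_down_closed:
  fixes ys :: "'a::linorder list"
  assumes "sorted ys" and down: "\<And>x y. x \<le> y \<Longrightarrow> Q y \<Longrightarrow> Q x" and "i < length ys"
  shows "Q (ys ! i) \<longleftrightarrow> i < length (filter Q ys)"
  using assms(1,3)
proof (induction ys arbitrary: i)
  case (Cons y ys)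
  show ?case
  proof (cases "Q y")
    case True
    then show ?thesis using Cons by (cases i) auto
  next
    case False
    then have "\<not> Q z" if "z \<in> set (y # ys)" for z
      using that Cons.prems(1) down[of y z] by auto
    then show ?thesis using Cons.prems(2) nth_mem by (metis filter_False less_nat_zero_code list.size(3))
  qed
qed simp

lemma order_statistic_down_closed:
  assumes "finite M" and "k \<in> {1..card M}" and down: "\<And>x y. x \<le> y \<Longrightarrow> Q y \<Longrightarrow> Q x"
  shows "Q (order_statistic k M t) \<longleftrightarrow> k \<le> card {i\<in>M. Q (t i)}"
proof -
  let ?ys = "sort (map t (sorted_list_of_set M))"
  have "length (filter Q ?ys) = length (filter (\<lambda>i. Q (t i)) (sorted_list_of_set M))"
    by (simp add: filter_sort filter_map comp_def)
  also have "\<dots> = card {i\<in>M. Q (t i)}"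
    using assms(1) distinct_card[of "filter (\<lambda>i. Q (t i)) (sorted_list_of_set M)"] by simp
  finally have len: "length (filter Q ?ys) = card {i\<in>M. Q (t i)}" .
  have "Q (?ys ! (k - 1)) \<longleftrightarrow> k - 1 < length (filter Q ?ys)"
    using assms by (intro sorted_nth_down_closed[OF _ down]) auto
  then show ?thesis
    using assms(2) by (auto simp: order_statistic_def len)
qed

lemma order_statistic_in_image:
  assumes "finite M" and "k \<in> {1..card M}"
  shows "order_statistic k M t \<in> t ` M"
proof -
  have "order_statistic k M t \<in> set (sort (map t (sorted_list_of_set M)))"
    unfolding order_statistic_def using assms by (intro nth_mem) auto
  then show ?thesis using assms(1) by simp
qed

text \<open>
  The \<open>k\<close>th smallest value is at most \<open>t j\<close> but not below it; without ties, the two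
  counts for \<open>\<le>\<close> and \<open><\<close> differ by one, which pins the rank of \<open>j\<close> down to \<open>k\<close>.
\<close>

lemma order_statistic_eq_iff:
  assumes "finite M" and k: "k \<in> {1..card M}" and inj: "inj_on t M" and j: "j \<in> M"
  shows "order_statistic k M t = t j \<longleftrightarrow> card {i\<in>M. t i \<le> t j} = k"
proof -
  have le: "order_statistic k M t \<le> t j \<longleftrightarrow> k \<le> card {i\<in>M. t i \<le> t j}"
    using assms by (intro order_statistic_down_closed) auto
  have less: "order_statistic k M t < t j \<longleftrightarrow> k \<le> card {i\<in>M. t i < t j}"
    using assms by (intro order_statistic_down_closed) auto
  have "{i\<in>M. t i \<le> t j} = insert j {i\<in>M. t i < t j}"
    using inj j by (auto simp: inj_on_def less_le)
  then have "card {i\<in>M. t i \<le> t j} = Suc (card {i\<in>M. t i < t j})"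
    using \<open>finite M\<close> by simp
  with le less show ?thesis by linarith
qed

text \<open>
  With \<open>Q = (\<lambda>x. a \<le> x)\<close> or \<open>Q = (\<lambda>x. a < x)\<close> this is the meaning of the structure function:
  the system is alive iff \<open>\<phi>\<close> accepts the set of components that are alive.  A working set
  all of whose members satisfy \<open>Q\<close> is contained in the set of all such components, and
  monotonicity of \<open>\<phi>\<close> passes from the former to the latter.
\<close>

lemma system_lifetime_up_closed:
  assumes semi: "semicoherent n \<phi>" and up: "\<And>x y. x \<le> y \<Longrightarrow> Q x \<Longrightarrow> Q y"
  shows "Q (system_lifetime n \<phi> t) \<longleftrightarrow> \<phi> {i\<in>{1..n}. Q (t i)} = 1"
proof -
  let ?S = "{A. A \<subseteq> {1..n} \<and> \<phi> A = 1}"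
  let ?U = "{i\<in>{1..n}. Q (t i)}"
  have fin: "finite ?S" by (rule finite_subset[of _ "Pow {1..n}"]) auto
  have ne: "?S \<noteq> {}" using semi by (auto simp: semicoherent_def)
  have Min_iff: "Q (Min (t ` A)) \<longleftrightarrow> A \<subseteq> ?U" if "A \<in> ?S" for A
  proof -
    have A: "finite A" "A \<noteq> {}"
      using that semi by (auto simp: semicoherent_def intro: finite_subset)
    show ?thesis
    proof
      assume Q: "Q (Min (t ` A))"
      have "Q (t i)" if "i \<in> A" for i
        by (rule up[OF _ Q]) (use A that in auto)
      then show "A \<subseteq> ?U" using that by blast
    next
      assume "A \<subseteq> ?U"
      moreover have "Min (t ` A) \<in> t ` A" using A by (intro Min_in) auto
      ultimately show "Q (Min (t ` A))" by force
    qed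
  qed
  have Max_iff: "Q (system_lifetime n \<phi> t) \<longleftrightarrow> (\<exists>A\<in>?S. Q (Min (t ` A)))"
  proof -
    let ?X = "(\<lambda>A. Min (t ` A)) ` ?S"
    have X: "finite ?X" "?X \<noteq> {}" using fin ne by auto
    show ?thesis
    proof
      assume "Q (system_lifetime n \<phi> t)"
      moreover have "system_lifetime n \<phi> t \<in> ?X"
        unfolding system_lifetime_def by (rule Max_in[OF X])
      ultimately show "\<exists>A\<in>?S. Q (Min (t ` A))" by (metis (no_types, lifting) imageE)
    next
      assume "\<exists>A\<in>?S. Q (Min (t ` A))"
      then obtain A where A: "A \<in> ?S" "Q (Min (t ` A))" by blast
      have "Min (t ` A) \<le> system_lifetime n \<phi> t"
        unfolding system_lifetime_def by (rule Max_ge[OF X(1)]) (use A in blast)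
      then show "Q (system_lifetime n \<phi> t)" using up A(2) by blast
    qed
  qed
  also have "\<dots> \<longleftrightarrow> (\<exists>A\<in>?S. A \<subseteq> ?U)" using Min_iff by (intro bex_cong refl)
  also have "\<dots> \<longleftrightarrow> \<phi> ?U = 1"
  proof
    assume "\<exists>A\<in>?S. A \<subseteq> ?U"
    then obtain A where A: "A \<subseteq> ?U" "\<phi> A = 1" by blast
    then have "1 \<le> \<phi> ?U" "\<phi> ?U \<in> {0, 1}"
      using semi unfolding semicoherent_def by (metis (lifting) mem_Collect_eq subsetI)+
    then show "\<phi> ?U = 1" by auto
  next
    assume "\<phi> ?U = 1"
    then show "\<exists>A\<in>?S. A \<subseteq> ?U" by (intro bexI[of _ ?U]) auto
  qed
  finally show ?thesis .
qed

section \<open>The components that outlive a given one\<close>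

definition survivors :: "nat \<Rightarrow> (nat \<Rightarrow> real) \<Rightarrow> nat \<Rightarrow> nat set" where
  "survivors n t j = {i\<in>{1..n}. t j < t i}"

lemma survivors_eq_iff_pointwise:
  assumes "A \<subseteq> {1..n}"
  shows "survivors n t j = A \<longleftrightarrow> (\<forall>i\<in>{1..n}. i \<in> A \<longleftrightarrow> t j < t i)"
  unfolding survivors_def using assms by blast

text \<open>
  The event in the definition of the relative quality function.  For \<open>A = {}\<close> the infimum
  is \<open>\<infinity>\<close>, which agrees with the empty condition on the survivors.
\<close>

lemma survivors_eq_iff:
  assumes "j \<in> {1..n}" and "A \<subseteq> {1..n} - {j}"
  shows "Max (t ` ({1..n} - A)) = t j \<and> ereal (t j) < (INF i\<in>A. ereal (t i)) \<longleftrightarrow>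
         survivors n t j = A"
proof -
  have finA: "finite A" using assms by (auto intro: finite_subset)
  have "Max (t ` ({1..n} - A)) = t j \<longleftrightarrow> (\<forall>i\<in>{1..n} - A. t i \<le> t j)"
  proof (subst Max_eq_iff)
    show "t ` ({1..n} - A) \<noteq> {}" using assms by blast
    have "t j \<in> t ` ({1..n} - A)" using assms by blast
    then show "(t j \<in> t ` ({1..n} - A) \<and> (\<forall>a\<in>t ` ({1..n} - A). a \<le> t j)) \<longleftrightarrow>
               (\<forall>i\<in>{1..n} - A. t i \<le> t j)" by simp
  qed simp
  moreover have "ereal (t j) < (INF i\<in>A. ereal (t i)) \<longleftrightarrow> (\<forall>i\<in>A. t j < t i)"
  proof (cases "A = {}")
    case False
    then show ?thesis
      using finA finite_less_Inf_iff[of "(\<lambda>i. ereal (t i)) ` A" "ereal (t j)"] by simp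
  qed (simp add: top_ereal_def)
  moreover have "survivors n t j = A \<longleftrightarrow> (\<forall>i\<in>{1..n}. i \<in> A \<longleftrightarrow> t j < t i)"
    using assms(2) by (intro survivors_eq_iff_pointwise) blast
  moreover have "\<dots> \<longleftrightarrow> (\<forall>i\<in>{1..n} - A. t i \<le> t j) \<and> (\<forall>i\<in>A. t j < t i)"
    unfolding not_less[symmetric] using assms(2) by blast
  ultimately show ?thesis by simp
qed

text \<open>
  Only the member \<open>j\<close> of \<open>M\<close> whose lifetime is the \<open>k\<close>th smallest has \<open>card (M - U) = k\<close> for
  its set \<open>U\<close> of survivors.  The system is alive just before time \<open>t j\<close> iff \<open>\<phi>\<close> accepts
  \<open>insert j U\<close>, and just after iff \<open>\<phi>\<close> accepts \<open>U\<close>, so the remaining difference is the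
  indicator of a system failure at \<open>t j\<close>.
\<close>

lemma lifetime_event_indicator:
  assumes semi: "semicoherent n \<phi>" and M: "M \<subseteq> {1..n}" and k: "k \<in> {1..card M}"
    and inj: "inj_on t {1..n}"
  shows "of_bool (system_lifetime n \<phi> t = order_statistic k M t) =
         (\<Sum>j\<in>M. of_bool (card (M - survivors n t j) = k) *
                 (\<phi> (insert j (survivors n t j)) - \<phi> (survivors n t j)))"
proof -
  have finM: "finite M" using M by (rule finite_subset) simp
  have injM: "inj_on t M" using inj M by (rule inj_on_subset)
  obtain j where j: "j \<in> M" "order_statistic k M t = t j"
    using order_statistic_in_image[OF finM k, of t] by blast
  let ?U = "survivors n t j"
  have rank: "card (M - survivors n t i) = k \<longleftrightarrow> i = j" if "i \<in> M" for i
  proof -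
    have "M - survivors n t i = {l\<in>M. t l \<le> t i}" using M by (auto simp: survivors_def)
    then have "card (M - survivors n t i) = k \<longleftrightarrow> order_statistic k M t = t i"
      using order_statistic_eq_iff[OF finM k injM that] by simp
    also have "\<dots> \<longleftrightarrow> i = j" using j that injM by (auto simp: inj_on_def)
    finally show ?thesis .
  qed
  have "(\<Sum>i\<in>M. of_bool (card (M - survivors n t i) = k) *
           (\<phi> (insert i (survivors n t i)) - \<phi> (survivors n t i))) =
        (\<Sum>i\<in>M. if i = j then \<phi> (insert j ?U) - \<phi> ?U else 0)"
    by (rule sum.cong[OF refl]) (auto simp: rank)
  also have "\<dots> = \<phi> (insert j ?U) - \<phi> ?U" using j finM by simp
  also have "\<dots> = of_bool (system_lifetime n \<phi> t = t j)"
  proof -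
    have ins: "{i\<in>{1..n}. t j \<le> t i} = insert j ?U"
    proof -
      have "t j \<le> t i \<longleftrightarrow> i = j \<or> t j < t i" if "i \<in> {1..n}" for i
      proof (cases "i = j")
        case False
        then have "t i \<noteq> t j" using inj_onD[OF inj, of i j] that j(1) M by blast
        then show ?thesis using False by linarith
      qed simp
      then show ?thesis using j(1) M unfolding survivors_def by blast
    qed
    have "t j \<le> system_lifetime n \<phi> t \<longleftrightarrow> \<phi> (insert j ?U) = 1"
      using system_lifetime_up_closed[OF semi, of "\<lambda>x. t j \<le> x" t] unfolding ins by simp
    moreover have "t j < system_lifetime n \<phi> t \<longleftrightarrow> \<phi> ?U = 1"
      using system_lifetime_up_closed[OF semi, of "\<lambda>x. t j < x" t] by (simp add: survivors_def)
    moreover have "insert j ?U \<subseteq> {1..n}" using j M by (auto simp: survivors_def)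
    then have "\<phi> ?U \<in> {0, 1}" "\<phi> (insert j ?U) \<in> {0, 1}" "\<phi> ?U \<le> \<phi> (insert j ?U)"
      using semi unfolding semicoherent_def by blast+
    ultimately show ?thesis by (cases "t j < system_lifetime n \<phi> t";
        cases "t j \<le> system_lifetime n \<phi> t") auto
  qed
  finally show ?thesis using j by simp
qed

section \<open>The subsignature in terms of relative qualities\<close>

text \<open>
  Sorting is not built from measurable operations, but whether the result exceeds a threshold
  is decided by a finite sum of indicators; similarly, the threshold events of the system
  lifetime are finite unions over the possible sets of living components.
\<close>

lemma order_statistic_measurable:
  assumes T: "\<And>i. i \<in> M \<Longrightarrow> T i \<in> borel_measurable P"
    and "finite M" and "k \<in> {1..card M}"
  shows "(\<lambda>\<omega>. order_statistic k M (\<lambda>i. T i \<omega>)) \<in> borel_measurable P"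
  unfolding borel_measurable_iff_le
proof
  fix a :: real
  have "order_statistic k M (\<lambda>i. T i \<omega>) \<le> a \<longleftrightarrow> real k \<le> (\<Sum>i\<in>M. of_bool (T i \<omega> \<le> a))" for \<omega>
    using order_statistic_down_closed[OF assms(2,3), of "\<lambda>x. x \<le> a" "\<lambda>i. T i \<omega>"] assms(2)
    by (simp add: sum_of_bool_eq Int_def)
  moreover have "{\<omega>\<in>space P. real k \<le> (\<Sum>i\<in>M. of_bool (T i \<omega> \<le> a))} \<in> sets P"
    using T by measurable
  ultimately show "{\<omega>\<in>space P. order_statistic k M (\<lambda>i. T i \<omega>) \<le> a} \<in> sets P" by simp
qed

lemma system_lifetime_measurable:
  assumes T: "\<And>i. i \<in> {1..n} \<Longrightarrow> T i \<in> borel_measurable P" and semi: "semicoherent n \<phi>"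
  shows "(\<lambda>\<omega>. system_lifetime n \<phi> (\<lambda>i. T i \<omega>)) \<in> borel_measurable P"
  unfolding borel_measurable_iff_ge
proof
  fix a :: real
  have "a \<le> system_lifetime n \<phi> (\<lambda>i. T i \<omega>) \<longleftrightarrow>
        (\<exists>A\<in>{A\<in>Pow {1..n}. \<phi> A = 1}. \<forall>i\<in>{1..n}. i \<in> A \<longleftrightarrow> a \<le> T i \<omega>)" (is "_ \<longleftrightarrow> ?R") for \<omega>
  proof -
    let ?U = "{i\<in>{1..n}. a \<le> T i \<omega>}"
    have "a \<le> system_lifetime n \<phi> (\<lambda>i. T i \<omega>) \<longleftrightarrow> \<phi> ?U = 1"
      by (rule system_lifetime_up_closed[OF semi]) auto
    also have "\<dots> \<longleftrightarrow> (\<exists>A\<in>{A\<in>Pow {1..n}. \<phi> A = 1}. A = ?U)" by auto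
    also have "\<dots> \<longleftrightarrow> ?R" by (intro bex_cong refl) auto
    finally show ?thesis .
  qed
  moreover have "{\<omega>\<in>space P. \<exists>A\<in>{A\<in>Pow {1..n}. \<phi> A = 1}. \<forall>i\<in>{1..n}. i \<in> A \<longleftrightarrow> a \<le> T i \<omega>} \<in> sets P"
    using T by (intro sets.sets_Collect_finite_Ex sets.sets_Collect_finite_All) (auto, measurable)
  ultimately show "{\<omega>\<in>space P. a \<le> system_lifetime n \<phi> (\<lambda>i. T i \<omega>)} \<in> sets P" by simp
qed

lemma survivors_event_measurable:
  assumes T: "\<And>i. i \<in> {1..n} \<Longrightarrow> T i \<in> borel_measurable P" and "j \<in> {1..n}" "A \<subseteq> {1..n}"
  shows "{\<omega>\<in>space P. survivors n (\<lambda>i. T i \<omega>) j = A} \<in> sets P"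
proof -
  have "survivors n (\<lambda>i. T i \<omega>) j = A \<longleftrightarrow> (\<forall>i\<in>{1..n}. i \<in> A \<longleftrightarrow> T j \<omega> < T i \<omega>)" for \<omega>
    using assms(3) by (rule survivors_eq_iff_pointwise)
  moreover have "{\<omega>\<in>space P. \<forall>i\<in>{1..n}. i \<in> A \<longleftrightarrow> T j \<omega> < T i \<omega>} \<in> sets P"
  proof (rule sets.sets_Collect_finite_All)
    fix i assume [measurable]: "i \<in> {1..n}"
    have [measurable]: "T i \<in> borel_measurable P" "T j \<in> borel_measurable P"
      using T \<open>i \<in> {1..n}\<close> assms(2) by auto
    show "{\<omega>\<in>space P. i \<in> A \<longleftrightarrow> T j \<omega> < T i \<omega>} \<in> sets P" by measurable
  qed simp
  ultimately show ?thesis by simp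
qed

text \<open>
  The expectation of \<open>lifetime_event_indicator\<close>, which holds almost surely because there are
  finitely many pairs of components and each ties with probability zero.
\<close>

lemma subsignature_eq_sum_rel_quality:
  assumes "prob_space P"
    and T: "\<And>i. i \<in> {1..n} \<Longrightarrow> T i \<in> borel_measurable P"
    and no_ties: "\<And>i j. i \<in> {1..n} \<Longrightarrow> j \<in> {1..n} \<Longrightarrow> i \<noteq> j \<Longrightarrow>
           measure P {\<omega>\<in>space P. T i \<omega> = T j \<omega>} = 0"
    and semi: "semicoherent n \<phi>"
    and M: "M \<subseteq> {1..n}" and k: "k \<in> {1..card M}"
  shows "subsignature P n \<phi> T k M =
         (\<Sum>j\<in>M. \<Sum>A\<in>Pow ({1..n} - {j}).
            of_bool (card (M - A) = k) * (\<phi> (insert j A) - \<phi> A) * rel_quality P n T j A)"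
proof -
  interpret prob_space P by fact
  have finM: "finite M" using M by (rule finite_subset) simp
  define E where "E j A = {\<omega>\<in>space P. survivors n (\<lambda>i. T i \<omega>) j = A}" for j A
  define c where "c j A = of_bool (card (M - A) = k) * (\<phi> (insert j A) - \<phi> A)" for j A
  define S where "S = {\<omega>\<in>space P. system_lifetime n \<phi> (\<lambda>i. T i \<omega>) = order_statistic k M (\<lambda>i. T i \<omega>)}"
  have E_sets: "E j A \<in> sets P" if "j \<in> M" "A \<in> Pow ({1..n} - {j})" for j A
    unfolding E_def using that M by (intro survivors_event_measurable T) auto
  have E_prob: "measure P (E j A) = rel_quality P n T j A" if "j \<in> M" "A \<in> Pow ({1..n} - {j})" for j A
    unfolding E_def rel_quality_def using that M by (subst survivors_eq_iff) auto
  have [measurable]: "(\<lambda>\<omega>. system_lifetime n \<phi> (\<lambda>i. T i \<omega>)) \<in> borel_measurable P"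
    using T semi by (rule system_lifetime_measurable)
  have [measurable]: "(\<lambda>\<omega>. order_statistic k M (\<lambda>i. T i \<omega>)) \<in> borel_measurable P"
    using T M finM k by (intro order_statistic_measurable) auto
  have S_sets: "S \<in> sets P" unfolding S_def by measurable
  have "AE \<omega> in P. \<forall>i\<in>{1..n}. \<forall>j\<in>{1..n}. i \<noteq> j \<longrightarrow> T i \<omega> \<noteq> T j \<omega>"
  proof (intro AE_finite_allI finite_atLeastAtMost)
    fix i j assume ij: "i \<in> {1..n}" "j \<in> {1..n}"
    have [measurable]: "T i \<in> borel_measurable P" "T j \<in> borel_measurable P" using T ij by auto
    show "AE \<omega> in P. i \<noteq> j \<longrightarrow> T i \<omega> \<noteq> T j \<omega>"
    proof (cases "i = j")
      case False
      have "prob {\<omega>\<in>space P. T i \<omega> = T j \<omega>} = 0" using no_ties ij False by blast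
      then have "AE \<omega> in P. \<not> (T i \<omega> = T j \<omega>)" by (subst (asm) prob_Collect_eq_0) auto
      then show ?thesis by simp
    qed simp
  qed
  then have "AE \<omega> in P. indicator S \<omega> = (\<Sum>j\<in>M. \<Sum>A\<in>Pow ({1..n} - {j}). c j A * indicator (E j A) \<omega>)"
  proof (rule AE_mp[OF _ AE_I2], intro impI)
    fix \<omega> assume \<omega>: "\<omega> \<in> space P"
      and "\<forall>i\<in>{1..n}. \<forall>j\<in>{1..n}. i \<noteq> j \<longrightarrow> T i \<omega> \<noteq> T j \<omega>"
    then have inj: "inj_on (\<lambda>i. T i \<omega>) {1..n}" by (auto simp: inj_on_def)
    have "indicator S \<omega> = (of_bool (system_lifetime n \<phi> (\<lambda>i. T i \<omega>) = order_statistic k M (\<lambda>i. T i \<omega>)) :: real)"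
      using \<omega> by (simp add: S_def indicator_def)
    also have "\<dots> = (\<Sum>j\<in>M. c j (survivors n (\<lambda>i. T i \<omega>) j))"
      unfolding c_def by (rule lifetime_event_indicator[OF semi M k inj])
    also have "\<dots> = (\<Sum>j\<in>M. \<Sum>A\<in>Pow ({1..n} - {j}). c j A * indicator (E j A) \<omega>)"
    proof (rule sum.cong[OF refl])
      fix j
      let ?U = "survivors n (\<lambda>i. T i \<omega>) j"
      have "?U \<in> Pow ({1..n} - {j})" by (auto simp: survivors_def)
      moreover have "c j A * indicator (E j A) \<omega> = (if ?U = A then c j A else 0)" for A
        using \<omega> by (auto simp: E_def)
      ultimately show "c j ?U = (\<Sum>A\<in>Pow ({1..n} - {j}). c j A * indicator (E j A) \<omega>)"
        by simp
    qed
    finally show "indicator S \<omega> = (\<Sum>j\<in>M. \<Sum>A\<in>Pow ({1..n} - {j}). c j A * indicator (E j A) \<omega>)" .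
  qed
  then have "(\<integral>\<omega>. indicator S \<omega> \<partial>P) =
             (\<integral>\<omega>. (\<Sum>j\<in>M. \<Sum>A\<in>Pow ({1..n} - {j}). c j A * indicator (E j A) \<omega>) \<partial>P)"
    using S_sets E_sets 
    by (intro integral_cong_AE borel_measurable_sum borel_measurable_times
        borel_measurable_const borel_measurable_indicator)
  also have "\<dots> = (\<Sum>j\<in>M. \<Sum>A\<in>Pow ({1..n} - {j}). c j A * measure P (E j A))"
  proof -
    have int: "integrable P (\<lambda>\<omega>. c j A * indicator (E j A) \<omega> :: real)"
      if "j \<in> M" "A \<in> Pow ({1..n} - {j})" for j A
      using E_sets[OF that] by (intro integrable_mult_right integrable_real_indicator)
        (auto simp: emeasure_eq_measure)
    have "(\<integral>\<omega>. (\<Sum>j\<in>M. \<Sum>A\<in>Pow ({1..n} - {j}). c j A * indicator (E j A) \<omega>) \<partial>P) =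
          (\<Sum>j\<in>M. \<integral>\<omega>. (\<Sum>A\<in>Pow ({1..n} - {j}). c j A * indicator (E j A) \<omega>) \<partial>P)"
      using int by (intro Bochner_Integration.integral_sum Bochner_Integration.integrable_sum)
    also have "\<dots> = (\<Sum>j\<in>M. \<Sum>A\<in>Pow ({1..n} - {j}). \<integral>\<omega>. c j A * indicator (E j A) \<omega> \<partial>P)"
      using int by (intro sum.cong refl Bochner_Integration.integral_sum)
    also have "\<dots> = (\<Sum>j\<in>M. \<Sum>A\<in>Pow ({1..n} - {j}). c j A * measure P (E j A))"
      using E_sets by (intro sum.cong refl) simp
    finally show ?thesis .
  qed
  also have "\<dots> = (\<Sum>j\<in>M. \<Sum>A\<in>Pow ({1..n} - {j}). c j A * rel_quality P n T j A)"
    using E_prob by (intro sum.cong refl) auto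
  finally show ?thesis
    using S_sets by (simp add: subsignature_def S_def c_def)
qed

section \<open>Beta weights\<close>

text \<open>
  The Beta integral of \<open>x ^ a * (1 - x) ^ (N - 1 - a)\<close> over the unit interval: the
  probability that \<open>a\<close> given components among \<open>N\<close> exchangeable ones are exactly those that
  outlive another given component.
\<close>

definition beta_weight :: "nat \<Rightarrow> nat \<Rightarrow> real" where
  "beta_weight N a = 1 / (real N * real ((N - 1) choose a))"

lemma beta_weight_fact: "beta_weight (a + c + 1) a = fact a * fact c / fact (a + c + 1)"
  by (simp add: beta_weight_def binomial_fact)

text \<open>
  Consistency under one additional component, which either fails before the distinguished
  component or outlives it.  In terms of the integral, \<open>(1 - x) + x = 1\<close>.
\<close>

lemma beta_weight_pascal:
  assumes "a < N"
  shows "beta_weight (Suc N) a + beta_weight (Suc N) (Suc a) = beta_weight N a"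
proof -
  obtain c where N: "N = a + c + 1" using assms less_imp_Suc_add by fastforce
  have "beta_weight (Suc N) a = fact a * fact (Suc c) / fact (Suc N)"
    using beta_weight_fact[of a "Suc c"] by (simp add: N)
  moreover have "beta_weight (Suc N) (Suc a) = fact (Suc a) * fact c / fact (Suc N)"
    using beta_weight_fact[of "Suc a" c] by (simp add: N)
  moreover have "beta_weight N a = fact a * fact c * real (Suc N) / fact (Suc N)"
    using beta_weight_fact[of a c] by (simp add: N)
  moreover have "fact a * fact (Suc c) + fact (Suc a) * fact c = fact a * fact c * real (Suc N)"
    by (simp add: N algebra_simps)
  ultimately show ?thesis by (metis add_divide_distrib)
qed

text \<open>
  Forgetting a whole set \<open>R\<close> of additional components, one at a time: \<open>Y\<close> is the part of \<open>R\<close>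
  that outlives the distinguished component.
\<close>

lemma sum_Pow_beta_weight:
  assumes "finite R" and "a < N"
  shows "(\<Sum>Y\<in>Pow R. beta_weight (N + card R) (a + card Y)) = beta_weight N a"
  using assms(1)
proof (induction R rule: finite_induct)
  case (insert x R)
  let ?w = "\<lambda>Y. beta_weight (N + card (insert x R)) (a + card Y)"
  have "(\<Sum>Y\<in>Pow (insert x R). ?w Y) = (\<Sum>Y\<in>Pow R. ?w Y) + (\<Sum>Y\<in>insert x ` Pow R. ?w Y)"
    unfolding Pow_insert using insert.hyps by (intro sum.union_disjoint) auto
  also have "(\<Sum>Y\<in>insert x ` Pow R. ?w Y) = (\<Sum>Y\<in>Pow R. ?w (insert x Y))"
    using insert.hyps by (subst sum.reindex) (auto simp: inj_on_def)
  also have "(\<Sum>Y\<in>Pow R. ?w Y) + (\<Sum>Y\<in>Pow R. ?w (insert x Y)) =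
             (\<Sum>Y\<in>Pow R. beta_weight (N + card R) (a + card Y))"
    unfolding sum.distrib[symmetric]
  proof (rule sum.cong[OF refl])
    fix Y assume Y: "Y \<in> Pow R"
    then have fin: "finite Y" "x \<notin> Y" using insert.hyps by (auto intro: finite_subset)
    have "card Y \<le> card R" using Y insert.hyps by (auto intro: card_mono)
    then have "a + card Y < N + card R" using assms(2) by simp
    from beta_weight_pascal[OF this]
    show "?w Y + ?w (insert x Y) = beta_weight (N + card R) (a + card Y)"
      using insert.hyps fin by simp
  qed
  finally show ?case using insert.IH by simp
qed simp

text \<open>
  The weight of \<open>N - k\<close> survivors, with the distinguished component failing in \<open>k\<close>th place,
  in the form that the final formula uses.
\<close>

lemma beta_weight_complement:
  assumes "1 \<le> k" and "k \<le> N"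
  shows "beta_weight N (N - k) = 1 / (real k * real (N choose k))"
proof -
  have "(N - 1) choose (N - k) = (N - 1) choose (k - 1)"
    using assms binomial_symmetric[of "k - 1" "N - 1"] by simp
  moreover have "k * (N choose k) = N * ((N - 1) choose (k - 1))"
    using assms times_binomial_minus1_eq[of k N] by simp
  ultimately show ?thesis
    unfolding beta_weight_def by (metis of_nat_mult)
qed

text \<open>
  A set \<open>A\<close> in the range of summation is determined by the set \<open>X = M - B - A\<close> of the \<open>k - 1\<close>
  members of \<open>M\<close> other than \<open>j\<close> that fail before \<open>j\<close>, and by the freely chosen part
  \<open>Y = A - (M \<union> B)\<close>.  Summing over \<open>Y\<close> reduces the weight to one on \<open>M \<union> B\<close> that no longer
  depends on \<open>X\<close>.
\<close>

lemma sum_beta_weight_between: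
  assumes "finite C" and M: "M \<subseteq> C" and B: "B \<subseteq> C" and j: "j \<in> M" "j \<in> B" and k: "1 \<le> k"
  shows "(\<Sum>A | A \<subseteq> C - {j} \<and> B - {j} \<subseteq> A \<and> card (M - A) = k. beta_weight (card C) (card A)) =
         real (card (M - B) choose (k - 1)) / (real k * real ((card (M - B) + card B) choose k))"
    (is "sum _ ?L = _")
proof -
  define V where "V = M - B"
  define R where "R = C - (M \<union> B)"
  define N where "N = card V + card B"
  let ?X = "{X. X \<subseteq> V \<and> card X = k - 1}"
  have fin: "finite V" "finite R" "finite B" "finite M" "finite C"
    using assms by (auto simp: V_def R_def intro: finite_subset)
  have disj: "V \<inter> R = {}" "B \<inter> R = {}" "V \<inter> B = {}" by (auto simp: V_def R_def)
  have "C = (V \<union> B) \<union> R" using M B by (auto simp: V_def R_def)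
  then have cardC: "card C = N + card R"
    using fin disj by (simp add: N_def card_Un_disjoint Int_Un_distrib2)
  have b: "1 \<le> card B" using j fin by (metis One_nat_def Suc_leI card_gt_0_iff empty_iff)
  have card_A: "card ((B - {j}) \<union> (V - X) \<union> Y) = (N - k) + card Y"
    if "X \<in> ?X" "Y \<in> Pow R" for X Y
  proof -
    have "card ((B - {j}) \<union> (V - X) \<union> Y) = card (B - {j}) + card (V - X) + card Y"
      using that fin disj finite_subset[of Y R]
      by (subst card_Un_disjoint; (subst card_Un_disjoint)?) auto
    moreover have "card (V - X) = card V - (k - 1)" "k - 1 \<le> card V"
      using that fin card_mono[of V X] finite_subset[of X V] by (auto simp: card_Diff_subset)
    ultimately show ?thesis using j b k fin by (simp add: N_def)
  qed
  have "sum (\<lambda>A. beta_weight (card C) (card A)) ?L =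
        (\<Sum>(X, Y)\<in>?X \<times> Pow R. beta_weight (N + card R) ((N - k) + card Y))"
  proof (rule sum.reindex_bij_witness[where i = "\<lambda>(X, Y). (B - {j}) \<union> (V - X) \<union> Y"
        and j = "\<lambda>A. (V - A, A \<inter> R)"])
    fix A assume A: "A \<in> ?L"
    show *: "(case (V - A, A \<inter> R) of (X, Y) \<Rightarrow> (B - {j}) \<union> (V - X) \<union> Y) = A"
      using A j M by (auto simp: V_def R_def)
    have "M - A = insert j (V - A)" "j \<notin> V - A" using A j by (auto simp: V_def)
    then have "card (M - A) = Suc (card (V - A))" using fin by simp
    then have "card (V - A) = k - 1" using A by auto
    then show mem: "(V - A, A \<inter> R) \<in> ?X \<times> Pow R" by auto
    show "(case (V - A, A \<inter> R) of (X, Y) \<Rightarrow> beta_weight (N + card R) ((N - k) + card Y)) =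
          beta_weight (card C) (card A)"
      using card_A[of "V - A" "A \<inter> R"] * mem by (simp add: cardC)
  next
    fix p assume p: "p \<in> ?X \<times> Pow R"
    obtain X Y where XY: "p = (X, Y)" by force
    have X: "X \<subseteq> V" "card X = k - 1" and Y: "Y \<subseteq> R" using p XY by auto
    let ?A = "(B - {j}) \<union> (V - X) \<union> Y"
    show "(V - (case p of (X, Y) \<Rightarrow> (B - {j}) \<union> (V - X) \<union> Y),
           (case p of (X, Y) \<Rightarrow> (B - {j}) \<union> (V - X) \<union> Y) \<inter> R) = p"
      using X Y unfolding XY by (auto simp: V_def R_def)
    have "M - ?A = insert j X" "j \<notin> X" using X Y j by (auto simp: V_def R_def)
    then have "card (M - ?A) = k" using X k fin finite_subset[of X V] by simp
    moreover have "?A \<subseteq> C - {j}" using X Y M B j by (auto simp: V_def R_def)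
    ultimately show "(case p of (X, Y) \<Rightarrow> (B - {j}) \<union> (V - X) \<union> Y) \<in> ?L" unfolding XY by auto
  qed
  also have "\<dots> = (\<Sum>X\<in>?X. \<Sum>Y\<in>Pow R. beta_weight (N + card R) ((N - k) + card Y))"
    by (rule sum.cartesian_product[symmetric])
  also have "\<dots> = real (card V choose (k - 1)) *
                   (\<Sum>Y\<in>Pow R. beta_weight (N + card R) ((N - k) + card Y))"
    using n_subsets[OF fin(1)] by simp
  also have "\<dots> = real (card V choose (k - 1)) / (real k * real (N choose k))"
    \<comment> \<open>Otherwise there is no \<open>X\<close>, and \<open>N - k\<close> may be a truncated difference.\<close>
  proof (cases "k - 1 \<le> card V")
    case True
    then have kN: "k \<le> N" using b k by (simp add: N_def)
    then have "(\<Sum>Y\<in>Pow R. beta_weight (N + card R) ((N - k) + card Y)) = beta_weight N (N - k)"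
      using k fin by (intro sum_Pow_beta_weight) auto
    then show ?thesis using beta_weight_complement[OF k kN] by simp
  qed (simp add: binomial_eq_0)
  finally show ?thesis by (simp add: N_def V_def)
qed

section \<open>Subsignatures from the signed domination function\<close>

text \<open>
  Of the terms \<open>d B\<close> with \<open>B \<subseteq> insert j A\<close>, those with \<open>j \<notin> B\<close> cancel against \<open>\<phi> A\<close>.  The
  sum ranges over all subsets of \<open>{1..n}\<close> so that it can be exchanged with the sum over \<open>A\<close>.
\<close>

lemma marginal_contribution_eq_sum:
  assumes "signed_domination n \<phi> d" and "j \<in> {1..n}" and A: "A \<subseteq> {1..n} - {j}"
  shows "\<phi> (insert j A) - \<phi> A = (\<Sum>B\<in>Pow {1..n}. of_bool (j \<in> B \<and> B - {j} \<subseteq> A) * d B)"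
proof -
  have finA: "finite A" "j \<notin> A" using A by (auto intro: finite_subset)
  have "\<phi> (insert j A) - \<phi> A = sum d (Pow (insert j A)) - sum d (Pow A)"
  proof -
    have "A \<subseteq> {1..n}" "insert j A \<subseteq> {1..n}" using assms by blast+
    then show ?thesis
      using \<open>signed_domination n \<phi> d\<close> unfolding signed_domination_sum by presburger
  qed
  also have "\<dots> = sum d (Pow (insert j A) - Pow A)"
    using finA by (subst sum_diff) auto
  also have "\<dots> = (\<Sum>B | B \<in> Pow {1..n} \<and> j \<in> B \<and> B - {j} \<subseteq> A. d B)"
    using assms finA by (intro sum.cong) auto
  also have "\<dots> = (\<Sum>B\<in>Pow {1..n}. if j \<in> B \<and> B - {j} \<subseteq> A then d B else 0)"
    by (rule sum.inter_filter) simp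
  also have "\<dots> = (\<Sum>B\<in>Pow {1..n}. of_bool (j \<in> B \<and> B - {j} \<subseteq> A) * d B)"
    by (intro sum.cong) auto
  finally show ?thesis .
qed

theorem corollary11:
  fixes P :: "'w measure"
    and n :: nat
    and \<phi> :: "nat set \<Rightarrow> real"
    and d :: "nat set \<Rightarrow> real"
    and T :: "nat \<Rightarrow> 'w \<Rightarrow> real"
    and M :: "nat set"
    and k :: nat
  assumes "prob_space P"
    and "\<And>i. i \<in> {1..n} \<Longrightarrow> T i \<in> borel_measurable P"
    and "\<And>i \<omega>. i \<in> {1..n} \<Longrightarrow> \<omega> \<in> space P \<Longrightarrow> 0 \<le> T i \<omega>"
    and no_ties: "\<And>i j. i \<in> {1..n} \<Longrightarrow> j \<in> {1..n} \<Longrightarrow> i \<noteq> j \<Longrightarrow>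
           measure P {\<omega>\<in>space P. T i \<omega> = T j \<omega>} = 0"
    and "semicoherent n \<phi>"
    and "signed_domination n \<phi> d"
    and q: "\<And>j A. j \<in> {1..n} \<Longrightarrow> A \<subseteq> {1..n} - {j} \<Longrightarrow>
           rel_quality P n T j A = 1 / (real n * real ((n - 1) choose card A))"
    and "M \<subseteq> {1..n}" and "M \<noteq> {}"
    and "k \<in> {1..card M}"
  shows "subsignature P n \<phi> T k M =
           (\<Sum>A | A \<subseteq> {1..n} \<and> k - 1 \<le> card (M - A) \<and> card (M - A) \<le> card M - 1.
              d A * ((real (card M) - real (card (M - A))) / real k) *
              (real (card (M - A) choose (k - 1)) / real ((card (M - A) + card A) choose k)))
         \<and> subsignature P n \<phi> T k M =
           (\<Sum>A | A \<subseteq> {1..n}.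
              d A * ((real (card M) - real (card (M - A))) / real k) *
              (real (card (M - A) choose (k - 1)) / real ((card (M - A) + card A) choose k)))"
proof -
  let ?C = "{1..n}"
  let ?g = "\<lambda>A. d A * ((real (card M) - real (card (M - A))) / real k) *
              (real (card (M - A) choose (k - 1)) / real ((card (M - A) + card A) choose k))"
  let ?W = "\<lambda>B. real (card (M - B) choose (k - 1)) /
                (real k * real ((card (M - B) + card B) choose k))"
  have M: "M \<subseteq> ?C" and k: "k \<in> {1..card M}" by fact+
  have finM: "finite M" using M by (rule finite_subset) simp
  have "subsignature P n \<phi> T k M =
        (\<Sum>j\<in>M. \<Sum>A\<in>Pow (?C - {j}).
            of_bool (card (M - A) = k) * (\<phi> (insert j A) - \<phi> A) * rel_quality P n T j A)"
    by (rule subsignature_eq_sum_rel_quality) fact+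
  also have "\<dots> = (\<Sum>j\<in>M. \<Sum>A\<in>Pow (?C - {j}). \<Sum>B\<in>Pow ?C.
      d B * (of_bool (j \<in> B \<and> B - {j} \<subseteq> A \<and> card (M - A) = k) * beta_weight n (card A)))"
  proof (intro sum.cong refl)
    fix j A assume "j \<in> M" and A: "A \<in> Pow (?C - {j})"
    then have j: "j \<in> ?C" using M by blast
    have "rel_quality P n T j A = beta_weight n (card A)"
      using q[OF j, of A] A by (simp add: beta_weight_def)
    moreover have "\<phi> (insert j A) - \<phi> A = (\<Sum>B\<in>Pow ?C. of_bool (j \<in> B \<and> B - {j} \<subseteq> A) * d B)"
      using marginal_contribution_eq_sum[OF \<open>signed_domination n \<phi> d\<close> j] A by blast
    ultimately show "of_bool (card (M - A) = k) * (\<phi> (insert j A) - \<phi> A) * rel_quality P n T j A =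
      (\<Sum>B\<in>Pow ?C. d B * (of_bool (j \<in> B \<and> B - {j} \<subseteq> A \<and> card (M - A) = k) * beta_weight n (card A)))"
      by (simp only: sum_distrib_left sum_distrib_right)
        (intro sum.cong refl, simp only: of_bool_conj mult_ac)
  qed
  also have "\<dots> = (\<Sum>B\<in>Pow ?C. \<Sum>j\<in>M. \<Sum>A\<in>Pow (?C - {j}).
      d B * (of_bool (j \<in> B \<and> B - {j} \<subseteq> A \<and> card (M - A) = k) * beta_weight n (card A)))"
    by (subst sum.swap[of _ "Pow ?C"]) (intro sum.cong refl sum.swap)
  also have "\<dots> = (\<Sum>B\<in>Pow ?C. ?g B)"
  proof (rule sum.cong[OF refl])
    fix B assume "B \<in> Pow ?C"
    then have B: "B \<subseteq> ?C" by simp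
    have "(\<Sum>A\<in>Pow (?C - {j}). d B *
            (of_bool (j \<in> B \<and> B - {j} \<subseteq> A \<and> card (M - A) = k) * beta_weight n (card A))) =
          (if j \<in> B then d B * ?W B else 0)" if j: "j \<in> M" for j
    proof (cases "j \<in> B")
      case True
      have "(\<Sum>A\<in>Pow (?C - {j}). of_bool (j \<in> B \<and> B - {j} \<subseteq> A \<and> card (M - A) = k) * beta_weight n (card A)) =
            (\<Sum>A\<in>Pow (?C - {j}). if B - {j} \<subseteq> A \<and> card (M - A) = k then beta_weight n (card A) else 0)"
        using True by (intro sum.cong) auto
      also have "\<dots> = (\<Sum>A | A \<in> Pow (?C - {j}) \<and> B - {j} \<subseteq> A \<and> card (M - A) = k. beta_weight n (card A))"
        by (rule sum.inter_filter[symmetric]) simp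
      also have "\<dots> = ?W B"
        using sum_beta_weight_between[OF _ M B j True, of k] k by simp
      finally show ?thesis using True by (simp add: sum_distrib_left[symmetric])
    qed simp
    then have "(\<Sum>j\<in>M. \<Sum>A\<in>Pow (?C - {j}). d B *
            (of_bool (j \<in> B \<and> B - {j} \<subseteq> A \<and> card (M - A) = k) * beta_weight n (card A))) =
          (\<Sum>j\<in>M. if j \<in> B then d B * ?W B else 0)" by (rule sum.cong[OF refl])
    also have "\<dots> = real (card (M \<inter> B)) * (d B * ?W B)"
      using finM by (simp add: sum.If_cases)
    also have "real (card (M \<inter> B)) = real (card M) - real (card (M - B))"
      using finM card_Int_Diff[of M B] by simp
    finally show "(\<Sum>j\<in>M. \<Sum>A\<in>Pow (?C - {j}). d B *
            (of_bool (j \<in> B \<and> B - {j} \<subseteq> A \<and> card (M - A) = k) * beta_weight n (card A))) = ?g B"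
      by simp
  qed
  also have "Pow ?C = {A. A \<subseteq> ?C}" by auto
  finally have full: "subsignature P n \<phi> T k M = (\<Sum>A | A \<subseteq> ?C. ?g A)" .
  \<comment> \<open>Outside the restricted range either the binomial coefficient
     or the factor \<open>card M - card (M - A)\<close> vanishes.\<close>
  moreover have "(\<Sum>A | A \<subseteq> ?C. ?g A) =
    (\<Sum>A | A \<subseteq> ?C \<and> k - 1 \<le> card (M - A) \<and> card (M - A) \<le> card M - 1. ?g A)"
  proof (rule sum.mono_neutral_right)
    show "\<forall>A\<in>{A. A \<subseteq> ?C} - {A. A \<subseteq> ?C \<and> k - 1 \<le> card (M - A) \<and> card (M - A) \<le> card M - 1}. ?g A = 0"
    proof
      fix A assume A: "A \<in> {A. A \<subseteq> ?C} -
        {A. A \<subseteq> ?C \<and> k - 1 \<le> card (M - A) \<and> card (M - A) \<le> card M - 1}"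
      have "card (M - A) \<le> card M" using finM by (intro card_mono) auto
      then have "card (M - A) < k - 1 \<or> card (M - A) = card M" using A by auto
      then show "?g A = 0" by (auto simp: binomial_eq_0)
    qed
  qed auto
  ultimately show ?thesis by simp
qed

end
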